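(* There is an absolute constant $C_0>0$ such that for every $C_1>0$ there exist a positive integer $N$, a family $\mathcal F\subset\mathcal D_N$ generating a graph $\mathcal T_{\mathcal F}$ that is both a cut bi-tree and a pruned bi-tree, a measure $\mu$ on $Q=[0,1]^2$ (at scale $N$), and a subfamily $\mathcal F'\subset\mathcal F$ with union $\Omega=\bigcup_{R_0\in\mathcal F'}R_0$, such that the box condition $$\sum_{R\in\mathcal F,\ R\subset R_0}\mu(R)^2\le C_0\,\mu(R_0)\qquad\text{for all } R_0\in\mathcal D_N$$ holds, but the Carleson condition with constant $C_1$ fails for $\Omega$, that is, $$\sum_{R\in\mathcal F,\ R\subset\Omega}\mu(R)^2> C_1\,\mu(\Omega).$$
   Context: Let $Q=[0,1]^2$ be the unit square and let $N$ be a positive integer. $\mathcal D_N$ denotes the family of all dyadic rectangles $R=H\times V\subset Q$, where $H,V$ are dyadic subintervals of the unit interval (half-open, of the form $[j2^{-n},(j+1)2^{-n})$) of length at least $2^{-N}$. The letter $\omega$ denotes the dyadic squares of size $2^{-N}\times2^{-N}$ in $Q$; every $R\in\mathcal D_N$ is a union of such squares. A measure $\mu$ on $Q$ (at scale $N$) is a collection of non-negative numbers $\{\mu(\omega)\}_\omega$, one for each $2^{-N}\times 2^{-N}$ dyadic square; for every set $U$ that is a union of squares $\omega$ one puts $\mu(U)=\sum_{\omega\subset U}\mu(\omega)$. Bi-tree: the directed graph $\mathcal T_{\mathcal D}$ has vertex set $\mathcal D_N$, with an edge from $R_1$ to $R_2$ if and only if $R_1$ is a parent of $R_2$, meaning that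 $R_2$ is obtained by splitting $R_1$, vertically or horizontally, into two equal halves and taking one of them (so a vertex may have two parents). For $\mathcal F\subset\mathcal D_N$, $\mathcal T_{\mathcal F}$ is the subgraph of $\mathcal T_{\mathcal D}$ induced on the vertex set $\mathcal F$. $\mathcal T_{\mathcal F}$ is called a pruned bi-tree if it is connected as an undirected graph and all the $2^{-N}\times2^{-N}$ squares $\omega$ belong to $\mathcal F$. $\mathcal T_{\mathcal F}$ is called a cut bi-tree if for every vertex in $\mathcal D_N\setminus\mathcal F$, all of its parents also belong to $\mathcal D_N\setminus\mathcal F$. *)

theory Defs
  imports Complex_Main "Graph_Theory.Digraph_Component"
begin

definition dyadic_interval :: "nat \<Rightarrow> nat \<Rightarrow> real set" where
  "dyadic_interval n j = {real j / 2 ^ n ..< (real j + 1) / 2 ^ n}"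

definition dyadic_intervals :: "nat \<Rightarrow> real set set" where
  "dyadic_intervals N = {dyadic_interval n j | n j. n \<le> N \<and> j < 2 ^ n}"

definition dyadic_rects :: "nat \<Rightarrow> (real \<times> real) set set" where
  "dyadic_rects N = {H \<times> V | H V. H \<in> dyadic_intervals N \<and> V \<in> dyadic_intervals N}"

definition small_squares :: "nat \<Rightarrow> (real \<times> real) set set" where
  "small_squares N = {dyadic_interval N i \<times> dyadic_interval N j | i j. i < 2 ^ N \<and> j < 2 ^ N}"

lemma finite_dyadic_intervals: "finite (dyadic_intervals N)"
proof -
  have "dyadic_intervals N = (\<Union>n\<in>{..N}. dyadic_interval n ` {..<2 ^ n})"
    by (auto simp: dyadic_intervals_def)
  then show ?thesis by simp
qed

lemma finite_dyadic_rects: "finite (dyadic_rects N)"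
proof -
  have "dyadic_rects N = (\<lambda>(H, V). H \<times> V) ` (dyadic_intervals N \<times> dyadic_intervals N)"
    by (auto simp: dyadic_rects_def)
  then show ?thesis by (simp add: finite_dyadic_intervals)
qed

lemma small_squares_subset: "small_squares N \<subseteq> dyadic_rects N"
  unfolding small_squares_def dyadic_rects_def dyadic_intervals_def by blast

(* A measure at scale N is given by its values on the small squares only; the values of the
   function elsewhere are irrelevant, since mass never uses them. *)
definition grid_measure :: "nat \<Rightarrow> ((real \<times> real) set \<Rightarrow> real) \<Rightarrow> bool" where
  "grid_measure N \<mu> \<longleftrightarrow> (\<forall>\<omega>\<in>small_squares N. 0 \<le> \<mu> \<omega>)"

definition mass :: "nat \<Rightarrow> ((real \<times> real) set \<Rightarrow> real) \<Rightarrow> (real \<times> real) set \<Rightarrow> real" where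
  "mass N \<mu> U = (\<Sum>\<omega> | \<omega> \<in> small_squares N \<and> \<omega> \<subseteq> U. \<mu> \<omega>)"

definition is_half :: "real set \<Rightarrow> real set \<Rightarrow> bool" where
  "is_half J I \<longleftrightarrow> (\<exists>a b. a < b \<and> I = {a..<b} \<and>
     (J = {a..<(a + b) / 2} \<or> J = {(a + b) / 2..<b}))"

definition is_parent :: "(real \<times> real) set \<Rightarrow> (real \<times> real) set \<Rightarrow> bool" where
  "is_parent R\<^sub>1 R\<^sub>2 \<longleftrightarrow> (\<exists>H V. R\<^sub>1 = H \<times> V \<and>
     ((\<exists>H'. is_half H' H \<and> R\<^sub>2 = H' \<times> V) \<or> (\<exists>V'. is_half V' V \<and> R\<^sub>2 = H \<times> V')))"

definition bitree ::
  "nat \<Rightarrow> ((real \<times> real) set, (real \<times> real) set \<times> (real \<times> real) set) pre_digraph" where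
  "bitree N = \<lparr> verts = dyadic_rects N,
     arcs = {(R\<^sub>1, R\<^sub>2). R\<^sub>1 \<in> dyadic_rects N \<and> R\<^sub>2 \<in> dyadic_rects N \<and> is_parent R\<^sub>1 R\<^sub>2},
     tail = fst, head = snd \<rparr>"

(* The qualified name is connectedness of the underlying undirected graph, which in
   Graph_Theory includes having a vertex; the name alone could mean the topological notion. *)
definition pruned_bitree :: "nat \<Rightarrow> (real \<times> real) set set \<Rightarrow> bool" where
  "pruned_bitree N F \<longleftrightarrow> F \<subseteq> dyadic_rects N \<and>
     Digraph_Component.connected (bitree N \<restriction> F) \<and> small_squares N \<subseteq> F"

definition cut_bitree :: "nat \<Rightarrow> (real \<times> real) set set \<Rightarrow> bool" where
  "cut_bitree N F \<longleftrightarrow> F \<subseteq> dyadic_rects N \<and>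
     (\<forall>R\<in>dyadic_rects N - F. \<forall>P. P \<rightarrow>\<^bsub>bitree N\<^esub> R \<longrightarrow> P \<in> dyadic_rects N - F)"

end

theory Submission
  imports Defs
begin

text \<open>
  The counterexample is Carleson's quilt. Rectangles of equal area \<open>2 ^ -N\<close> are produced recursively:
  a copy of the previous family is squeezed into each even vertical strip of width
  \<open>2 ^ (-M-1)\<close>, where \<open>2 ^ -M\<close> is the finest scale used so far, and likewise into the even horizontal
  strips. The number of rectangles inside \<open>R\<^sub>0\<close> stays at most \<open>2 ^ N \<bar>R\<^sub>0\<bar>\<close>, and all
  rectangles together have total area 1. The vertical and the horizontal part of the union depend on
  disjoint sets of binary digits, hence are independent, so the area \<open>a\<close> of the union drops to
  \<open>a - a\<^sup>2 / 4\<close> and tends to 0.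

  Take \<open>\<mu> = 2 ^ N\<close> times Lebesgue measure, so that every quilt rectangle has mass 1, and let \<open>\<F>\<close> consist of
  all subrectangles of quilt rectangles together with all rectangles that have a side of length
  \<open>2 ^ -N\<close>; the latter make the graph connected. Masses squared decay geometrically under
  subdivision, so a quilt rectangle inside \<open>R\<^sub>0\<close> contributes a bounded amount to the box sum. A quilt
  rectangle that meets \<open>R\<^sub>0\<close> without lying inside it is longer than \<open>R\<^sub>0\<close> in one direction, hence
  thin in the other; all sufficiently thin subrectangles of \<open>R\<^sub>0\<close> together contribute at most a
  multiple of \<open>\<mu>(R\<^sub>0)\<close>.
\<close>

section \<open>Arithmetic of integer division and of dyadic fractions\<close>

lemma div_nat_eq_iff:
  fixes x d i :: nat
  assumes "d > 0"
  shows "x div d = i \<longleftrightarrow> i * d \<le> x \<and> x < (i + 1) * d"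
proof
  assume "x div d = i"
  then show "i * d \<le> x \<and> x < (i + 1) * d"
    using assms by (metis Suc_eq_plus1 div_times_less_eq_dividend dividend_less_div_times mult.commute mult_Suc)
next
  assume "i * d \<le> x \<and> x < (i + 1) * d"
  then show "x div d = i"
    by (intro div_nat_eqI) (auto simp: mult.commute)
qed

text \<open>Compares endpoints of dyadic intervals of two levels: \<open>b\<close> is the coarser
  denominator, \<open>a * b\<close> the finer one.\<close>

lemma divide_cancel_common_factor:
  fixes a b u v :: real
  assumes "a > 0" "b > 0"
  shows "u / b \<le> v / (a * b) \<longleftrightarrow> u * a \<le> v"
    and "v / (a * b) \<le> u / b \<longleftrightarrow> v \<le> u * a"
    and "v / (a * b) < u / b \<longleftrightarrow> v < u * a"
proof -
  have ab: "a * b > 0" and u: "u / b * (a * b) = u * a"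
    using assms by simp_all
  show "u / b \<le> v / (a * b) \<longleftrightarrow> u * a \<le> v"
    and "v / (a * b) \<le> u / b \<longleftrightarrow> v \<le> u * a"
    and "v / (a * b) < u / b \<longleftrightarrow> v < u * a"
    by (simp_all only: pos_le_divide_eq[OF ab] pos_divide_le_eq[OF ab] pos_divide_less_eq[OF ab] u)
qed

subsection \<open>Dyadic intervals and rectangles in coordinates\<close>

definition dyI :: "nat \<times> nat \<Rightarrow> real set" where
  "dyI a = dyadic_interval (fst a) (snd a)"

definition drect :: "(nat \<times> nat) \<times> (nat \<times> nat) \<Rightarrow> (real \<times> real) set" where
  "drect r = dyI (fst r) \<times> dyI (snd r)"

text \<open>Dropping the last \<open>fst a - fst b\<close> binary digits of an index gives the index
  of the ancestor interval, so this is inclusion of dyadic intervals in terms of natural numbers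
  only.\<close>

definition refines :: "nat \<times> nat \<Rightarrow> nat \<times> nat \<Rightarrow> bool" where
  "refines a b \<longleftrightarrow> fst b \<le> fst a \<and> snd a div 2 ^ (fst a - fst b) = snd b"

definition levels :: "nat \<Rightarrow> (nat \<times> nat) set" where
  "levels N = {(k, i). k \<le> N \<and> i < 2 ^ k}"

lemma dyadic_interval_left: "real i / 2 ^ k \<in> dyadic_interval k i"
  by (simp add: dyadic_interval_def divide_strict_right_mono)

lemma grid_point_mem_iff:
  assumes "k \<le> n"
  shows "real x / 2 ^ n \<in> dyadic_interval k i \<longleftrightarrow> x div 2 ^ (n - k) = i"
proof -
  have p: "(2::real) ^ n = 2 ^ (n - k) * 2 ^ k"
    using assms by (simp flip: power_add)
  have "real i / 2 ^ k \<le> real x / 2 ^ n \<longleftrightarrow> real i * 2 ^ (n - k) \<le> real x"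
    unfolding p by (rule divide_cancel_common_factor) simp_all
  also have "\<dots> \<longleftrightarrow> i * 2 ^ (n - k) \<le> x"
    using of_nat_le_iff[of "i * 2 ^ (n - k)" x, where 'a = real] by simp
  finally have 1: "real i / 2 ^ k \<le> real x / 2 ^ n \<longleftrightarrow> i * 2 ^ (n - k) \<le> x" .
  have "real x / 2 ^ n < (real i + 1) / 2 ^ k \<longleftrightarrow> real x < (real i + 1) * 2 ^ (n - k)"
    unfolding p by (rule divide_cancel_common_factor) simp_all
  also have "\<dots> \<longleftrightarrow> x < (i + 1) * 2 ^ (n - k)"
    using of_nat_less_iff[of x "(i + 1) * 2 ^ (n - k)", where 'a = real] by (simp add: distrib_right add.commute)
  finally have 2: "real x / 2 ^ n < (real i + 1) / 2 ^ k \<longleftrightarrow> x < (i + 1) * 2 ^ (n - k)" .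
  show ?thesis
    by (subst div_nat_eq_iff) (auto simp: dyadic_interval_def 1 2)
qed

lemma dyI_nonempty: "dyI a \<noteq> {}"
  using dyadic_interval_left unfolding dyI_def by blast

text \<open>From left to right, comparing lengths orders the levels; the left endpoint of the
  smaller interval is then a grid point whose membership is decided by integer division.\<close>

lemma dyI_subset_iff: "dyI a \<subseteq> dyI b \<longleftrightarrow> refines a b"
proof -
  obtain k i l j where ab: "a = (k, i)" "b = (l, j)" by (metis surj_pair)
  show ?thesis
  proof
    assume s: "dyI a \<subseteq> dyI b"
    have ne: "real i / 2 ^ k < (real i + 1) / 2 ^ k" by (simp add: divide_strict_right_mono)
    have e: "real j / 2 ^ l \<le> real i / 2 ^ k" "(real i + 1) / 2 ^ k \<le> (real j + 1) / 2 ^ l"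
      using s ne by (auto simp: ab dyI_def dyadic_interval_def)
    have "1 / 2 ^ k = (real i + 1) / 2 ^ k - real i / 2 ^ k"
      by (simp add: field_simps)
    also have "\<dots> \<le> (real j + 1) / 2 ^ l - real j / 2 ^ l"
      using e by linarith
    also have "\<dots> = 1 / 2 ^ l"
      by (simp add: field_simps)
    finally have "(2::real) ^ l \<le> 2 ^ k"
      by (simp add: field_simps)
    then have lk: "l \<le> k" by simp
    moreover have "real i / 2 ^ k \<in> dyadic_interval l j"
      using s dyadic_interval_left by (auto simp: ab dyI_def)
    ultimately show "refines a b"
      using grid_point_mem_iff by (simp add: refines_def ab)
  next
    assume r: "refines a b"
    then have lk: "l \<le> k" and d: "i div 2 ^ (k - l) = j"
      by (auto simp: refines_def ab)
    have p: "(2::real) ^ k = 2 ^ (k - l) * 2 ^ l"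
      using lk by (simp flip: power_add)
    have b: "j * 2 ^ (k - l) \<le> i" "i + 1 \<le> (j + 1) * 2 ^ (k - l)"
      using d by (auto simp: div_nat_eq_iff)
    then have "real j * 2 ^ (k - l) \<le> real i" "real i + 1 \<le> (real j + 1) * 2 ^ (k - l)"
      using of_nat_le_iff[of "j * 2 ^ (k - l)" i, where 'a = real]
      of_nat_le_iff[of "i + 1" "(j + 1) * 2 ^ (k - l)", where 'a = real]
    by (simp_all add: distrib_right add.commute)
    then have "real j / 2 ^ l \<le> real i / 2 ^ k" "(real i + 1) / 2 ^ k \<le> (real j + 1) / 2 ^ l"
      unfolding p by (simp_all only: divide_cancel_common_factor zero_less_power zero_less_numeral)
    then show "dyI a \<subseteq> dyI b"
      by (auto simp: ab dyI_def dyadic_interval_def)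
  qed
qed

lemma refines_refl: "refines a a"
  and refines_trans: "refines a b \<Longrightarrow> refines b c \<Longrightarrow> refines a c"
  by (auto simp flip: dyI_subset_iff)

text \<open>Dyadic intervals with a common subinterval are nested: both indices are prefixes of the
  same binary word.\<close>

lemma refines_comparable:
  assumes "refines a b" "refines a c" "fst c \<le> fst b"
  shows "refines b c"
proof -
  have "snd b div 2 ^ (fst b - fst c) = snd a div (2 ^ (fst a - fst b) * 2 ^ (fst b - fst c))"
    using assms by (auto simp: refines_def div_mult2_eq)
  also have "\<dots> = snd c"
    using assms by (auto simp: refines_def simp flip: power_add)
  finally show ?thesis using assms by (auto simp: refines_def)
qed

lemma drect_subset_iff:
  "drect r \<subseteq> drect s \<longleftrightarrow> refines (fst r) (fst s) \<and> refines (snd r) (snd s)"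
  by (simp add: drect_def times_subset_iff dyI_nonempty dyI_subset_iff)

lemma inj_drect: "inj drect"
proof (rule injI)
  fix r s assume "drect r = drect s"
  then have "refines (fst r) (fst s)" "refines (fst s) (fst r)"
    "refines (snd r) (snd s)" "refines (snd s) (snd r)"
    using drect_subset_iff by blast+
  then show "r = s"
    by (auto simp: refines_def prod_eq_iff)
qed

lemma dyadic_intervals_eq: "dyadic_intervals N = dyI ` levels N"
  by (force simp: dyadic_intervals_def dyI_def levels_def)

lemma dyadic_rects_eq: "dyadic_rects N = drect ` (levels N \<times> levels N)"
  by (force simp: dyadic_rects_def dyadic_intervals_eq drect_def)

lemma small_squares_eq:
  "small_squares N = (\<lambda>(x, y). drect ((N, x), (N, y))) ` ({..<2 ^ N} \<times> {..<2 ^ N})"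
  by (force simp: small_squares_def drect_def dyI_def)

lemma finite_levels: "finite (levels N)"
proof -
  have "levels N \<subseteq> (SIGMA k:{..N}. {..<2 ^ k})" by (auto simp: levels_def)
  then show ?thesis by (rule finite_subset) auto
qed

lemma card_div_fibre: "d > 0 \<Longrightarrow> card {x::nat. x div d = i} = d"
proof -
  assume "d > 0"
  then have "{x. x div d = i} = {i * d..<(i + 1) * d}"
    by (auto simp: div_nat_eq_iff)
  then show ?thesis by simp
qed

lemma finite_div_fibre: "d > 0 \<Longrightarrow> finite {x::nat. x div d = i}"
  by (rule card_ge_0_finite) (simp add: card_div_fibre)

text \<open>The constant weight 2^-N on squares of area 4^-N is 2^N times Lebesgue measure. A
  rectangle of levels k and l contains 2^(N-k) * 2^(N-l) small squares.\<close>

lemma mass_drect: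
  assumes "r \<in> levels N \<times> levels N"
  shows "mass N (\<lambda>_. 1 / 2 ^ N) (drect r) = 2 ^ N / 2 ^ (fst (fst r) + fst (snd r))"
proof -
  obtain k i l j where r: "r = ((k, i), (l, j))" by (metis surj_pair)
  have kl: "k \<le> N" "l \<le> N" and ij: "i < 2 ^ k" "j < 2 ^ l"
    using assms by (auto simp: r levels_def)
  \<comment> \<open>The range restriction on grid coordinates follows from refinement, so the fibres
    of \<open>div\<close> are counted in full.\<close>
  have *: "refines (N, x) (k, i) \<Longrightarrow> x < 2 ^ N" if "k \<le> N" "i < 2 ^ k" for x k i
  proof -
    assume "refines (N, x) (k, i)"
    then have "x div 2 ^ (N - k) = i" by (simp add: refines_def)
    then have "x < (i + 1) * 2 ^ (N - k)" by (simp add: div_nat_eq_iff)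
    also have "\<dots> \<le> 2 ^ k * 2 ^ (N - k)" using that by (intro mult_right_mono) auto
    also have "\<dots> = 2 ^ N" using that by (simp flip: power_add)
    finally show "x < 2 ^ N" .
  qed
  have "{\<omega>. \<omega> \<in> small_squares N \<and> \<omega> \<subseteq> drect r} =
    (\<lambda>(x, y). drect ((N, x), (N, y))) `
      {z \<in> {..<2 ^ N} \<times> {..<2 ^ N}. drect ((N, fst z), (N, snd z)) \<subseteq> drect r}"
    unfolding small_squares_eq by (force simp: image_iff)
  also have "{z \<in> {..<2 ^ N} \<times> {..<2 ^ N}. drect ((N, fst z), (N, snd z)) \<subseteq> drect r} =
    {x. x div 2 ^ (N - k) = i} \<times> {y. y div 2 ^ (N - l) = j}"
    unfolding drect_subset_iff
    using *[OF kl(1) ij(1)] *[OF kl(2) ij(2)] kl by (auto simp: r refines_def)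
  finally have "{\<omega>. \<omega> \<in> small_squares N \<and> \<omega> \<subseteq> drect r} =
    (\<lambda>(x, y). drect ((N, x), (N, y))) `
      ({x. x div 2 ^ (N - k) = i} \<times> {y. y div 2 ^ (N - l) = j})" .
  moreover have "inj_on (\<lambda>(x, y). drect ((N, x), (N, y))) S" for S
    by (auto simp: inj_on_def dest: injD[OF inj_drect])
  ultimately have "mass N (\<lambda>_. 1 / 2 ^ N) (drect r) = 2 ^ (N - k) * 2 ^ (N - l) / 2 ^ N"
    by (simp add: mass_def card_image card_cartesian_product card_div_fibre)
  then show ?thesis
    using kl by (simp add: r power_diff power_add field_simps)
qed

subsection \<open>Carleson's quilt\<close>

text \<open>The index \<open>2 * u\<close> runs through the even strips of width \<open>2 ^ (-M-1)\<close>; \<open>M\<close> will be the depth of \<open>G\<close>.\<close>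

definition shift :: "nat \<Rightarrow> ((nat \<times> nat) \<times> 'b) set \<Rightarrow> ((nat \<times> nat) \<times> 'b) set" where
  "shift M G = (\<lambda>(u, (k, i), b). ((Suc M + k, 2 * u * 2 ^ k + i), b)) ` ({..<2 ^ M} \<times> G)"

text \<open>This is both the area exponent of every rectangle in \<open>quilt n\<close> and a bound
  on its side exponents. With M = \<open>depth n\<close>, squeezing into strips of width 2^(-M-1)
  adds M + 1 to the area exponent M.\<close>

primrec depth :: "nat \<Rightarrow> nat" where
  "depth 0 = 0"
| "depth (Suc n) = 2 * depth n + 1"

primrec quilt :: "nat \<Rightarrow> ((nat \<times> nat) \<times> (nat \<times> nat)) set" where
  "quilt 0 = {((0, 0), (0, 0))}"
| "quilt (Suc n) = shift (depth n) (quilt n) \<union> prod.swap ` shift (depth n) (quilt n)"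

definition count_below ::
  "((nat \<times> nat) \<times> (nat \<times> nat)) set \<Rightarrow> nat \<times> nat \<Rightarrow> nat \<times> nat \<Rightarrow> nat" where
  "count_below G a b = card {r \<in> G. refines (fst r) a \<and> refines (snd r) b}"

lemma finite_shift: "finite G \<Longrightarrow> finite (shift M G)"
  by (simp add: shift_def)

lemma finite_quilt: "finite (quilt n)"
  by (induction n) (auto intro: finite_shift)

lemma shift_index_less:
  assumes "u < 2 ^ M" "i < 2 ^ k"
  shows "2 * u * 2 ^ k + i < (2::nat) ^ (Suc M + k)"
proof -
  have "2 * u * 2 ^ k + i < (2 * u + 1) * 2 ^ k"
    using assms by simp
  also have "\<dots> \<le> 2 ^ Suc M * 2 ^ k"
    using assms by (intro mult_right_mono) auto
  finally show ?thesis by (simp add: power_add)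
qed

lemma quilt_elem:
  "r \<in> quilt n \<Longrightarrow> fst (fst r) + fst (snd r) = depth n \<and>
     snd (fst r) < 2 ^ fst (fst r) \<and> snd (snd r) < 2 ^ fst (snd r)"
proof (induction n arbitrary: r)
  case 0
  then show ?case by simp
next
  case (Suc n)
  have *: "fst (fst s) + fst (snd s) = depth (Suc n) \<and>
     snd (fst s) < 2 ^ fst (fst s) \<and> snd (snd s) < 2 ^ fst (snd s)"
    if s: "s \<in> shift (depth n) (quilt n)" for s
  proof -
    obtain u k i b where g: "((k, i), b) \<in> quilt n" and u: "u < 2 ^ depth n"
      and s: "s = ((Suc (depth n) + k, 2 * u * 2 ^ k + i), b)"
      using s by (auto simp: shift_def)
    show ?thesis
      using Suc.IH[OF g] shift_index_less[OF u, of i k] by (simp add: s)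
  qed
  show ?case
    using Suc.prems by (auto dest!: *)
qed

lemma quilt_subset_levels: "quilt n \<subseteq> levels (depth n) \<times> levels (depth n)"
  using quilt_elem by (fastforce simp: levels_def)

text \<open>The strip number and the old index are quotient and remainder of the new index modulo
  2^k, hence the parametrisation is injective.\<close>

lemma card_shift:
  assumes "\<And>k i b. ((k, i), b) \<in> G \<Longrightarrow> i < 2 ^ k"
  shows "card (shift M G) = 2 ^ M * card G"
proof -
  have "inj_on (\<lambda>(u, (k, i), b). ((Suc M + k, 2 * u * 2 ^ k + i), b)) ({..<2 ^ M} \<times> G)"
  proof (rule inj_onI)
    fix x y
    assume x: "x \<in> {..<2 ^ M} \<times> G" and y: "y \<in> {..<2 ^ M} \<times> G"
      and e: "(\<lambda>(u, (k, i), b). ((Suc M + k, 2 * u * 2 ^ k + i), b)) x =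
        (\<lambda>(u, (k, i), b). ((Suc M + k, 2 * u * 2 ^ k + i), b)) y"
    obtain u k i b u' k' i' b' where xy: "x = (u, (k, i), b)" "y = (u', (k', i'), b')"
      by (metis surj_pair)
    have k: "k' = k" "b' = b" and eq: "2 * u * 2 ^ k + i = 2 * u' * 2 ^ k + i'"
      using e by (auto simp: xy)
    have "i < 2 ^ k" "i' < 2 ^ k" using assms x y k by (auto simp: xy)
    then have "(2 * u * 2 ^ k + i) div 2 ^ k = 2 * u \<and> (2 * u * 2 ^ k + i) mod 2 ^ k = i"
      "(2 * u' * 2 ^ k + i') div 2 ^ k = 2 * u' \<and> (2 * u' * 2 ^ k + i') mod 2 ^ k = i'"
      by simp_all
    then show "x = y"
      using eq by (simp add: xy k)
  qed
  then show ?thesis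
    by (simp add: shift_def card_image card_cartesian_product)
qed

lemma card_quilt: "card (quilt n) = 2 ^ depth n"
proof (induction n)
  case 0
  then show ?case by simp
next
  case (Suc n)
  let ?S = "shift (depth n) (quilt n)"
  \<comment> \<open>A common member would have both side exponents at least
    \<open>depth n + 1\<close>, one too many in total for its area.\<close>
  have "?S \<inter> prod.swap ` ?S = {}"
  proof (rule equals0I)
    fix r assume "r \<in> ?S \<inter> prod.swap ` ?S"
    then have r: "r \<in> quilt (Suc n)" and ge: "Suc (depth n) \<le> fst (fst r)" "Suc (depth n) \<le> fst (snd r)"
      by (auto simp: shift_def)
    then show False
      using quilt_elem[OF r] by simp
  qed
  then have "card (quilt (Suc n)) = card ?S + card ?S"
    using finite_shift[OF finite_quilt, of "depth n" n]
    by (simp add: card_Un_disjoint card_image)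
  also have "card ?S = 2 ^ depth n * 2 ^ depth n"
    using quilt_elem by (subst card_shift) (fastforce simp: Suc.IH)+
  finally show ?case by (simp add: mult_2 power_add)
qed

section \<open>Packing bound for the quilt\<close>

lemma count_below_swap: "count_below (prod.swap ` G) a b = count_below G b a"
proof -
  have "{r \<in> prod.swap ` G. refines (fst r) a \<and> refines (snd r) b} =
    prod.swap ` {r \<in> G. refines (fst r) b \<and> refines (snd r) a}" by auto
  then show ?thesis by (simp add: count_below_def card_image)
qed

text \<open>An interval no wider than a strip lies in a single strip, so undoing the squeeze maps
  the members below it injectively into the old family.\<close>

lemma count_below_shift_fine:
  assumes a: "Suc M \<le> fst a" and "finite G" and lt: "\<And>k i b. ((k, i), b) \<in> G \<Longrightarrow> i < 2 ^ k"
  shows "\<exists>a'. fst a' = fst a - Suc M \<and> count_below (shift M G) a b \<le> count_below G a' b"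
proof -
  obtain p i\<^sub>0 where ap: "a = (p, i\<^sub>0)" by fastforce
  \<comment> \<open>The quotient \<open>?u\<close> of the index names the strip; the remainder is
    the position inside the strip, rescaled to the unit interval. A member below \<open>a\<close>
    forces \<open>?u\<close> to be even.\<close>
  let ?a = "(p - Suc M, i\<^sub>0 mod 2 ^ (p - Suc M))"
  let ?u = "i\<^sub>0 div 2 ^ (p - Suc M)"
  have "{r \<in> shift M G. refines (fst r) a \<and> refines (snd r) b} \<subseteq>
    (\<lambda>((k, i), b). ((Suc M + k, ?u * 2 ^ k + i), b)) ` {r \<in> G. refines (fst r) ?a \<and> refines (snd r) b}"
  proof
    fix r assume "r \<in> {r \<in> shift M G. refines (fst r) a \<and> refines (snd r) b}"
    then obtain u k i c where g: "((k, i), c) \<in> G" and r: "r = ((Suc M + k, 2 * u * 2 ^ k + i), c)"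
      and ra: "refines (Suc M + k, 2 * u * 2 ^ k + i) a" and rb: "refines c b"
      by (auto simp: shift_def)
    define d where "d = Suc M + k - p"
    have k: "k = p - Suc M + d" using ra a by (auto simp: ap refines_def d_def)
    have e: "2 * u * 2 ^ k = (2 * u * 2 ^ (p - Suc M)) * 2 ^ d"
      by (simp add: k power_add)
    have i0: "i\<^sub>0 = 2 * u * 2 ^ (p - Suc M) + i div 2 ^ d"
      using ra unfolding refines_def ap e by (simp add: d_def)
    have "i < 2 ^ d * 2 ^ (p - Suc M)"
      using lt[OF g] by (simp add: k power_add mult.commute)
    then have "i div 2 ^ d < 2 ^ (p - Suc M)"
      by (simp add: less_mult_imp_div_less mult.commute)
    then have "?u = 2 * u" "i\<^sub>0 mod 2 ^ (p - Suc M) = i div 2 ^ d"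
      by (simp_all add: i0)
    then show "r \<in> (\<lambda>((k, i), b). ((Suc M + k, ?u * 2 ^ k + i), b)) `
        {r \<in> G. refines (fst r) ?a \<and> refines (snd r) b}"
      using g rb by (auto simp: r refines_def k intro!: image_eqI[where x = "((k, i), c)"])
  qed
  then have "count_below (shift M G) a b \<le> count_below G ?a b"
    using \<open>finite G\<close> unfolding count_below_def by (intro surj_card_le) auto
  then show ?thesis by (intro exI[of _ ?a]) (simp add: ap)
qed

text \<open>An interval of level p at most M contains 2^(M-p) even strips. Each holds a full copy of
  the old family, so only the condition on the second side remains.\<close>

lemma count_below_shift_coarse:
  assumes a: "fst a \<le> M" and "finite G" and lt: "\<And>k i b. ((k, i), b) \<in> G \<Longrightarrow> i < 2 ^ k"
  shows "count_below (shift M G) a b \<le> 2 ^ (M - fst a) * count_below G (0, 0) b"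
proof -
  obtain p i\<^sub>0 where ap: "a = (p, i\<^sub>0)" by fastforce
  let ?X = "{u. u div 2 ^ (M - p) = i\<^sub>0} \<times> {r \<in> G. refines (fst r) (0, 0) \<and> refines (snd r) b}"
  have "{r \<in> shift M G. refines (fst r) a \<and> refines (snd r) b} \<subseteq>
    (\<lambda>(u, (k, i), b). ((Suc M + k, 2 * u * 2 ^ k + i), b)) ` ?X"
  proof
    fix r assume "r \<in> {r \<in> shift M G. refines (fst r) a \<and> refines (snd r) b}"
    then obtain u k i c where g: "((k, i), c) \<in> G" and r: "r = ((Suc M + k, 2 * u * 2 ^ k + i), c)"
      and ra: "refines (Suc M + k, 2 * u * 2 ^ k + i) a" and rb: "refines c b"
      by (auto simp: shift_def)
    have i: "i < 2 ^ k" using lt[OF g] .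
    have "i\<^sub>0 = (2 * u * 2 ^ k + i) div 2 ^ (k + Suc (M - p))"
      using ra a by (simp add: refines_def ap Suc_diff_le add.commute)
    also have "(2::nat) ^ (k + Suc (M - p)) = 2 ^ k * 2 * 2 ^ (M - p)"
      by (simp add: power_add)
    also have "(2 * u * 2 ^ k + i) div (2 ^ k * 2 * 2 ^ (M - p)) = u div 2 ^ (M - p)"
    proof -
      have "(2 * u * 2 ^ k + i) div 2 ^ k = 2 * u" using i by simp
      then show ?thesis by (simp only: div_mult2_eq) simp
    qed
    finally have "u \<in> {u. u div 2 ^ (M - p) = i\<^sub>0}" by simp
    moreover have "((k, i), c) \<in> {r \<in> G. refines (fst r) (0, 0) \<and> refines (snd r) b}"
      using g rb i by (simp add: refines_def)
    ultimately show "r \<in> (\<lambda>(u, (k, i), b). ((Suc M + k, 2 * u * 2 ^ k + i), b)) ` ?X"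
      by (intro image_eqI[where x = "(u, (k, i), c)"]) (auto simp: r)
  qed
  then have "count_below (shift M G) a b \<le> card ?X"
    using \<open>finite G\<close> unfolding count_below_def
    by (intro surj_card_le) (auto intro!: finite_cartesian_product finite_div_fibre)
  then show ?thesis by (simp add: ap card_cartesian_product card_div_fibre count_below_def)
qed

text \<open>With M = \<open>depth n\<close>, if one side of the box is of level above M, then one
  half of the quilt has no member below it, and the other half obeys the whole bound after undoing
  the squeeze. If both levels are at most M, each half uses at most half of the bound.\<close>

lemma quilt_packing:
  "count_below (quilt n) a b * 2 ^ (fst a + fst b) \<le> 2 ^ depth n"
proof (induction n arbitrary: a b)
  case 0
  show ?case
  proof (cases "fst a = 0 \<and> fst b = 0")
    case True
    have "count_below (quilt 0) a b \<le> card (quilt 0)"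
      unfolding count_below_def by (rule card_mono) auto
    with True show ?thesis
      by (simp add: card_quilt del: quilt.simps)
  next
    case False
    have "{r \<in> quilt 0. refines (fst r) a \<and> refines (snd r) b} = {}"
      using False by (auto simp: refines_def)
    then show ?thesis
      by (simp only: count_below_def card.empty mult_zero_left zero_le)
  qed
next
  case (Suc n)
  let ?M = "depth n" and ?S = "shift (depth n) (quilt n)"
  have lt: "i < 2 ^ k" if "((k, i), b) \<in> quilt n" for k i b
    using quilt_elem[OF that] by simp
  have "{r \<in> quilt (Suc n). refines (fst r) a \<and> refines (snd r) b} =
    {r \<in> ?S. refines (fst r) a \<and> refines (snd r) b} \<union>
    {r \<in> prod.swap ` ?S. refines (fst r) a \<and> refines (snd r) b}" by auto
  then have split: "count_below (quilt (Suc n)) a b \<le> count_below ?S a b + count_below ?S b a"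
    unfolding count_below_swap[of ?S a b, symmetric] by (simp only: count_below_def card_Un_le)
  have fine: "count_below ?S a b * 2 ^ (fst a + fst b) \<le> 2 ^ (2 * ?M + 1)"
    if fa: "Suc ?M \<le> fst a" for a b
  proof -
    obtain a' where a': "fst a' = fst a - Suc ?M" "count_below ?S a b \<le> count_below (quilt n) a' b"
      using count_below_shift_fine[where G = "quilt n", OF fa finite_quilt] lt by blast
    have "count_below ?S a b * 2 ^ (fst a + fst b) \<le>
      count_below (quilt n) a' b * 2 ^ (fst a' + fst b + Suc ?M)"
      using a' fa by (intro mult_mono) auto
    also have "\<dots> = count_below (quilt n) a' b * 2 ^ (fst a' + fst b) * 2 ^ Suc ?M"
      by (simp add: power_add)
    also have "\<dots> \<le> 2 ^ ?M * 2 ^ Suc ?M"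
      by (intro mult_right_mono Suc.IH) simp
    also have "\<dots> = 2 ^ (2 * ?M + 1)" by (simp add: mult_2 power_add distrib_left)
    finally show ?thesis .
  qed
  have thin: "count_below ?S a b = 0" if "Suc ?M \<le> fst b" for a b
  proof -
    have "\<not> refines (snd r) b" if r: "r \<in> ?S" for r
    proof
      assume rb: "refines (snd r) b"
      obtain k i c where g: "((k, i), c) \<in> quilt n" "snd r = c"
        using r by (auto simp: shift_def)
      then show False
        using quilt_elem[OF g(1)] rb \<open>Suc ?M \<le> fst b\<close> by (simp add: refines_def)
    qed
    then have "{r \<in> ?S. refines (fst r) a \<and> refines (snd r) b} = {}" by blast
    then show ?thesis by (simp only: count_below_def card.empty)
  qed
  have coarse: "count_below ?S a b * 2 ^ (fst a + fst b) \<le> 2 ^ (2 * ?M)"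
    if "fst a \<le> ?M" for a b
  proof -
    have "count_below ?S a b * 2 ^ (fst a + fst b) \<le>
      2 ^ (?M - fst a) * count_below (quilt n) (0, 0) b * 2 ^ (fst a + fst b)"
      by (intro mult_right_mono count_below_shift_coarse that finite_quilt lt) auto
    also have "\<dots> = 2 ^ (?M - fst a + fst a) * (count_below (quilt n) (0, 0) b * 2 ^ fst b)"
      unfolding power_add by (simp only: mult_ac)
    also have "\<dots> \<le> 2 ^ ?M * 2 ^ ?M"
      using Suc.IH[of "(0, 0)" b] that by (intro mult_mono) auto
    also have "\<dots> = 2 ^ (2 * ?M)" by (simp add: mult_2 power_add)
    finally show ?thesis .
  qed
  have "(count_below ?S a b + count_below ?S b a) * 2 ^ (fst a + fst b) \<le> 2 ^ (2 * ?M + 1)"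
  proof (cases "Suc ?M \<le> fst a \<or> Suc ?M \<le> fst b")
    case True
    then show ?thesis
    proof
      assume "Suc ?M \<le> fst a"
      from fine[OF this, of b] thin[OF this, of b] show ?thesis
        by (simp only: add_0_right)
    next
      assume "Suc ?M \<le> fst b"
      from fine[OF this, of a] thin[OF this, of a] show ?thesis
        by (simp only: add_0_left add.commute[of "fst b"])
    qed
  next
    case False
    then have "fst a \<le> ?M" "fst b \<le> ?M" by simp_all
    from coarse[OF this(1), of b] coarse[OF this(2), of a]
    have "count_below ?S a b * 2 ^ (fst a + fst b) \<le> 2 ^ (2 * ?M)"
      "count_below ?S b a * 2 ^ (fst a + fst b) \<le> 2 ^ (2 * ?M)"
      by (simp_all only: add.commute[of "fst b"])
    then have "(count_below ?S a b + count_below ?S b a) * 2 ^ (fst a + fst b) \<le> 2 * 2 ^ (2 * ?M)"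
      unfolding distrib_right by linarith
    then show ?thesis by simp
  qed
  then have "count_below (quilt (Suc n)) a b * 2 ^ (fst a + fst b) \<le> 2 ^ (2 * ?M + 1)"
    using mult_right_mono[OF split, of "2 ^ (fst a + fst b)"] by linarith
  then show ?case by (simp only: depth.simps)
qed

subsection \<open>The area of the union\<close>

text \<open>The union of the quilt in grid coordinates at its finest scale; its area is
  \<open>card (cells n) / 4 ^ depth n\<close>.\<close>

definition cells :: "nat \<Rightarrow> (nat \<times> nat) set" where
  "cells n = {(x, y). x < 2 ^ depth n \<and> y < 2 ^ depth n \<and>
     (\<exists>r\<in>quilt n. refines (depth n, x) (fst r) \<and> refines (depth n, y) (snd r))}"

lemma finite_cells: "finite (cells n)"
proof -
  have "cells n \<subseteq> {..<2 ^ depth n} \<times> {..<2 ^ depth n}" by (auto simp: cells_def)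
  then show ?thesis by (rule finite_subset) simp
qed

text \<open>The strip number consists of the leading \<open>depth n + 1\<close> digits of
  \<open>x\<close> and is even; the squeezed copy sees only the remaining digits of
  \<open>x\<close>. The other direction is not squeezed, so it sees only the leading digits of
  \<open>y\<close>.\<close>

lemma cells_shift:
  assumes "x < 2 ^ depth (Suc n)" "y < 2 ^ depth (Suc n)" and r: "r \<in> shift (depth n) (quilt n)"
    and xr: "refines (depth (Suc n), x) (fst r)" and yr: "refines (depth (Suc n), y) (snd r)"
  shows "even (x div 2 ^ depth n)" and "(x mod 2 ^ depth n, y div 2 ^ Suc (depth n)) \<in> cells n"
proof -
  let ?M = "depth n"
  obtain u k i l j where g: "((k, i), (l, j)) \<in> quilt n"
    and r: "r = ((Suc ?M + k, 2 * u * 2 ^ k + i), (l, j))"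
    using r by (auto simp: shift_def)
  have k: "k \<le> ?M" and l: "l \<le> ?M" and i: "i < 2 ^ k"
    using quilt_elem[OF g] by auto
  define q x' where "q = x div 2 ^ ?M" and "x' = x mod 2 ^ ?M"
  have M: "(2::nat) ^ ?M = 2 ^ k * 2 ^ (?M - k)"
    using k by (simp flip: power_add)
  have x': "x' < 2 ^ k * 2 ^ (?M - k)" by (simp add: x'_def flip: M)
  have "2 * u * 2 ^ k + i = x div 2 ^ (?M - k)"
    using xr k by (simp add: r refines_def mult_2)
  also have "x = q * 2 ^ k * 2 ^ (?M - k) + x'"
    unfolding mult.assoc M[symmetric] by (simp only: q_def x'_def div_mult_mod_eq)
  also have "\<dots> div 2 ^ (?M - k) = q * 2 ^ k + x' div 2 ^ (?M - k)"
    by simp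
  finally have e: "2 * u * 2 ^ k + i = q * 2 ^ k + x' div 2 ^ (?M - k)" .
  have lt: "x' div 2 ^ (?M - k) < 2 ^ k"
    using x' by (rule less_mult_imp_div_less)
  have "2 * u = q"
    using arg_cong[OF e, of "\<lambda>z. z div 2 ^ k"] i lt by simp
  then show "even (x div 2 ^ ?M)" unfolding q_def[symmetric] by auto
  have "i = x' div 2 ^ (?M - k)"
    using e \<open>2 * u = q\<close> by simp
  then have "refines (?M, x') (k, i)" using k by (simp add: refines_def)
  moreover have "Suc ?M + (?M - l) = depth (Suc n) - l" using l by simp
  then have "y div 2 ^ Suc ?M div 2 ^ (?M - l) = y div 2 ^ (depth (Suc n) - l)"
    by (metis div_mult2_eq power_add)
  then have "refines (?M, y div 2 ^ Suc ?M) (l, j)"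
    using yr l unfolding r refines_def by (metis fst_conv snd_conv)
  moreover have "y div 2 ^ Suc ?M < 2 ^ ?M"
    using assms(2) by (intro less_mult_imp_div_less) (simp add: mult_2 power_add distrib_left)
  ultimately show "(x mod 2 ^ ?M, y div 2 ^ Suc ?M) \<in> cells n"
    using g by (force simp: cells_def x'_def)
qed

text \<open>A coordinate at the new scale is a word (\<open>depth n\<close> digits, one digit, \<open>depth n\<close> digits).
  Membership in the vertical part constrains the last block of \<open>x\<close> and the first block of \<open>y\<close>,
  membership in the horizontal part the other two long blocks; independence yields the square.\<close>

lemma card_cells_Suc:
  "card (cells (Suc n)) + (card (cells n))\<^sup>2 \<le> 4 * (2 ^ depth n * 2 ^ depth n) * card (cells n)"
proof -
  let ?M = "depth n"
  let ?C = "cells n" and ?B = "{..<(2::nat) ^ depth n} \<times> {..<(2::nat) ^ depth n}"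
  \<comment> \<open>\<open>?f\<close> assembles two coordinates from their blocks: the pair
    constrained by the vertical part, the pair constrained by the horizontal part, then the middle
    digits of the two coordinates.\<close>
  let ?f = "\<lambda>((x, u), (y, w), d, b). (w * 2 ^ Suc ?M + d * 2 ^ ?M + x, u * 2 ^ Suc ?M + b * 2 ^ ?M + y)"
  let ?V = "?C \<times> ?B \<times> {0::nat} \<times> {0, 1::nat}" and ?H = "?B \<times> ?C \<times> {0, 1::nat} \<times> {0::nat}"
  have digits: "z = z div 2 ^ Suc ?M * 2 ^ Suc ?M + (z div 2 ^ ?M mod 2) * 2 ^ ?M + z mod 2 ^ ?M"
    for z :: nat
  proof -
    have "z div 2 ^ Suc ?M = z div 2 ^ ?M div 2"
      by (simp add: div_mult2_eq mult.commute[of 2])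
    then have "z div 2 ^ Suc ?M * 2 ^ Suc ?M + (z div 2 ^ ?M mod 2) * 2 ^ ?M
      = (z div 2 ^ ?M div 2 * 2 + z div 2 ^ ?M mod 2) * 2 ^ ?M"
      by (simp only: distrib_right power_Suc mult.assoc)
    then show ?thesis by (simp only: div_mult_mod_eq)
  qed
  have top: "z div 2 ^ Suc ?M < 2 ^ ?M" if "z < 2 ^ depth (Suc n)" for z :: nat
    using that by (intro less_mult_imp_div_less) (simp add: mult_2 power_add distrib_left)
  have bit: "z mod 2 = 0 \<or> z mod 2 = 1" for z :: nat by auto
  have fin: "finite ?V" "finite ?H" "finite (?C \<times> ?C \<times> {0::nat} \<times> {0::nat})"
    using finite_cells by auto
  have CB: "?C \<subseteq> ?B" by (auto simp: cells_def)
  have "cells (Suc n) \<subseteq> ?f ` (?V \<union> ?H)"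
  proof
    fix z assume z: "z \<in> cells (Suc n)"
    obtain x y where zxy: "z = (x, y)" by fastforce
    have lt: "x < 2 ^ depth (Suc n)" "y < 2 ^ depth (Suc n)"
      using z by (auto simp: cells_def zxy)
    obtain r where "r \<in> quilt (Suc n)" and
      xr: "refines (depth (Suc n), x) (fst r)" and yr: "refines (depth (Suc n), y) (snd r)"
      using z by (auto simp only: cells_def zxy mem_Collect_eq case_prod_conv)
    let ?w = "((x mod 2 ^ ?M, y div 2 ^ Suc ?M), (y mod 2 ^ ?M, x div 2 ^ Suc ?M),
      x div 2 ^ ?M mod 2, y div 2 ^ ?M mod 2)"
    have "z = ?f ?w"
      unfolding zxy using digits[of x] digits[of y] by (simp only: case_prod_conv)
    moreover from \<open>r \<in> quilt (Suc n)\<close> consider "r \<in> shift ?M (quilt n)" | "prod.swap r \<in> shift ?M (quilt n)"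
      by fastforce
    then have "?w \<in> ?V \<union> ?H"
    proof cases
      case 1
      from cells_shift[OF lt 1 xr yr] have "?w \<in> ?V"
        using bit top[OF lt(1)] by simp
      then show ?thesis ..
    next
      case 2
      have "refines (depth (Suc n), y) (fst (prod.swap r))" "refines (depth (Suc n), x) (snd (prod.swap r))"
        using xr yr by simp_all
      from cells_shift[OF lt(2,1) 2 this] have "?w \<in> ?H"
        using bit top[OF lt(2)] by simp
      then show ?thesis ..
    qed
    ultimately show "z \<in> ?f ` (?V \<union> ?H)" by (rule image_eqI)
  qed
  then have "card (cells (Suc n)) \<le> card (?V \<union> ?H)"
    using fin by (intro surj_card_le) auto
  \<comment> \<open>The two conditions concern different blocks, so the overlap is a product and its
    size is a square.\<close>
  moreover have "?V \<inter> ?H = ?C \<times> ?C \<times> {0} \<times> {0}"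
    using CB by auto
  then have "card (?V \<union> ?H) + card (?C \<times> ?C \<times> {0::nat} \<times> {0::nat}) = card ?V + card ?H"
    using card_Un_Int[OF fin(1,2)] by (simp only:)
  moreover have "card ?V = card ?C * (2 ^ ?M * 2 ^ ?M) * 2"
    "card ?H = card ?C * (2 ^ ?M * 2 ^ ?M) * 2"
    "card (?C \<times> ?C \<times> {0::nat} \<times> {0::nat}) = (card ?C)\<^sup>2"
    by (simp_all add: card_cartesian_product power2_eq_square)
  moreover have "card ?C * (2 ^ ?M * 2 ^ ?M) * 2 + card ?C * (2 ^ ?M * 2 ^ ?M) * 2 =
      4 * (2 ^ ?M * 2 ^ ?M) * card ?C"
    by simp
  ultimately show ?thesis by linarith
qed

text \<open>For the density a, the recursion reads a' <= a - a^2/4, so 1/a grows by at least 1/4 per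
  step, starting from 1.\<close>

lemma cells_density: "real (card (cells n)) \<le> 4 / (real n + 4) * 4 ^ depth n"
proof (induction n)
  case 0
  have "cells 0 \<subseteq> {(0, 0)}" by (auto simp: cells_def)
  then have "card (cells 0) \<le> card {(0::nat, 0::nat)}" by (intro card_mono) auto
  then show ?case by simp
next
  case (Suc n)
  define a t where "a = real (card (cells n)) / 4 ^ depth n" and "t = 4 / (real n + 4)"
  have c: "real (card (cells n)) = a * 4 ^ depth n" by (simp add: a_def)
  have le: "a \<le> t" using Suc by (simp add: a_def t_def field_simps)
  have t: "0 < t" "t \<le> 1" by (auto simp: t_def)
  \<comment> \<open>The map s - s^2/4 is increasing for s <= 2, and a <= t <= 1.\<close>
  have "a - a\<^sup>2 / 4 \<le> t - t\<^sup>2 / 4"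
  proof -
    have "0 \<le> (t - a) * (1 - (t + a) / 4)"
      using le t by (intro mult_nonneg_nonneg) auto
    then show ?thesis by (simp add: power2_eq_square algebra_simps diff_divide_distrib)
  qed
  also have "t - t\<^sup>2 / 4 \<le> 4 / (real (Suc n) + 4)"
  proof -
    have "t - t\<^sup>2 / 4 = 4 * (real n + 3) / (real n + 4)\<^sup>2"
      by (simp add: t_def power2_eq_square divide_simps)
    also have "\<dots> \<le> 4 / (real n + 5)"
    proof -
      have "4 * (real n + 3) * (real n + 5) \<le> 4 * (real n + 4)\<^sup>2"
        by (simp add: power2_eq_square algebra_simps)
      moreover have "(real n + 4)\<^sup>2 > 0" by simp
      ultimately show ?thesis
        by (simp only: pos_divide_le_eq) (simp add: pos_le_divide_eq)
    qed
    finally show ?thesis by (simp add: add.commute)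
  qed
  finally have key: "a - a\<^sup>2 / 4 \<le> 4 / (real (Suc n) + 4)" .
  have "real (card (cells (Suc n)) + (card (cells n))\<^sup>2)
      \<le> real (4 * (2 ^ depth n * 2 ^ depth n) * card (cells n))"
    using card_cells_Suc by (simp only: of_nat_le_iff)
  then have "real (card (cells (Suc n))) \<le>
      4 * (2 ^ depth n * 2 ^ depth n) * (a * 4 ^ depth n) - (a * 4 ^ depth n)\<^sup>2"
    by (simp add: c)
  also have "(2::real) ^ depth n * 2 ^ depth n = 4 ^ depth n"
    by (simp flip: power_mult_distrib)
  also have "4 * 4 ^ depth n * (a * 4 ^ depth n) - (a * 4 ^ depth n)\<^sup>2 =
      (a - a\<^sup>2 / 4) * 4 ^ depth (Suc n)"
    by (simp add: power2_eq_square mult_2 power_add left_diff_distrib)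
  also have "\<dots> \<le> 4 / (real (Suc n) + 4) * 4 ^ depth (Suc n)"
    by (intro mult_right_mono key) simp
  finally show ?case .
qed

subsection \<open>The box condition\<close>

lemma sum_half_powers_le: "(\<Sum>k=m..N. 1 / 2 ^ k :: real) \<le> 2 / 2 ^ m"
proof -
  have "(\<Sum>k=m..N. 1 / 2 ^ k :: real) = (\<Sum>k=m..N. (1 / 2) ^ k)"
    by (simp add: power_one_over)
  also have "\<dots> \<le> 2 * (1 / 2) ^ m"
    by (simp add: sum_gp)
  finally show ?thesis by (simp add: power_one_over)
qed

text \<open>Level k has 2^(k - \<open>fst b\<close>) refinements of weight 4^-k each, which leaves a
  geometric series in 2^-k starting at the larger of \<open>c\<close> and
  \<open>fst b\<close>.\<close>

lemma sum_refinements_le: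
  "(\<Sum>a | a \<in> levels N \<and> refines a b \<and> c \<le> fst a. 1 / 4 ^ fst a :: real) \<le> 2 / (2 ^ fst b * 2 ^ c)"
proof -
  let ?p = "fst b" and ?m = "max c (fst b)"
  let ?X = "\<lambda>k. {i::nat. i div 2 ^ (k - ?p) = snd b}"
  have fin: "finite (SIGMA k:{?m..N}. ?X k)"
    by (auto intro!: finite_div_fibre)
  have "(\<Sum>a | a \<in> levels N \<and> refines a b \<and> c \<le> fst a. 1 / 4 ^ fst a :: real)
      \<le> (\<Sum>a\<in>(SIGMA k:{?m..N}. ?X k). 1 / 4 ^ fst a)"
    by (rule sum_mono2[OF fin]) (auto simp: levels_def refines_def)
  also have "\<dots> = (\<Sum>k=?m..N. \<Sum>i\<in>?X k. 1 / 4 ^ k)"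
    by (subst sum.Sigma) (auto intro!: finite_div_fibre sum.cong)
  also have "\<dots> = (\<Sum>k=?m..N. 1 / 2 ^ ?p * (1 / 2 ^ k))"
  proof (rule sum.cong)
    fix k assume k: "k \<in> {?m..N}"
    have "(4::real) ^ k = 2 ^ k * 2 ^ k"
      by (simp flip: power_mult_distrib)
    moreover have "(2::real) ^ k = 2 ^ (k - ?p) * 2 ^ ?p"
      using k by (simp flip: power_add)
    ultimately show "(\<Sum>i\<in>?X k. 1 / 4 ^ k :: real) = 1 / 2 ^ ?p * (1 / 2 ^ k)"
      by (simp add: card_div_fibre)
  qed simp
  also have "\<dots> \<le> 1 / 2 ^ ?p * (2 / 2 ^ ?m)"
    unfolding sum_distrib_left[symmetric] by (intro mult_left_mono sum_half_powers_le) simp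
  also have "\<dots> \<le> 1 / 2 ^ ?p * (2 / 2 ^ c)"
    by (intro mult_left_mono divide_left_mono) auto
  finally show ?thesis by simp
qed

text \<open>Squared masses are 4^N times a product of one-dimensional weights, so the sum factors.
  The two tails produce the extra factor 2^N / 2^(c+d), which is at most 1.\<close>

lemma sum_mass_sq_le:
  assumes P: "P \<in> levels N \<times> levels N" and cd: "N \<le> c + d"
    and S: "S \<subseteq> {r \<in> levels N \<times> levels N. refines (fst r) (fst P) \<and> refines (snd r) (snd P) \<and>
      c \<le> fst (fst r) \<and> d \<le> fst (snd r)}"
  shows "(\<Sum>r\<in>S. (mass N (\<lambda>_. 1 / 2 ^ N) (drect r))\<^sup>2) \<le> 4 * mass N (\<lambda>_. 1 / 2 ^ N) (drect P)"
proof -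
  let ?X = "\<lambda>a c. {b. b \<in> levels N \<and> refines b a \<and> c \<le> fst b}"
  let ?Y = "?X (fst P) c \<times> ?X (snd P) d"
  have SY: "S \<subseteq> ?Y" using S by auto
  have fin: "finite ?Y" using finite_levels by auto
  have four: "(4::real) ^ k = 2 ^ k * 2 ^ k" for k
    by (simp flip: power_mult_distrib)
  have "(\<Sum>r\<in>S. (mass N (\<lambda>_. 1 / 2 ^ N) (drect r))\<^sup>2) \<le>
      (\<Sum>r\<in>?Y. (mass N (\<lambda>_. 1 / 2 ^ N) (drect r))\<^sup>2)"
    by (rule sum_mono2[OF fin SY]) simp
  also have "\<dots> = (\<Sum>r\<in>?Y. 4 ^ N * (1 / 4 ^ fst (fst r) * (1 / 4 ^ fst (snd r))))"
    by (rule sum.cong[OF refl], subst mass_drect) (auto simp: power2_eq_square four power_add)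
  also have "\<dots> = 4 ^ N * ((\<Sum>b\<in>?X (fst P) c. 1 / 4 ^ fst b) * (\<Sum>b\<in>?X (snd P) d. 1 / 4 ^ fst b))"
  proof -
    have "(\<Sum>b\<in>?X (fst P) c. 1 / 4 ^ fst b) * (\<Sum>b\<in>?X (snd P) d. 1 / 4 ^ fst b :: real) =
      (\<Sum>r\<in>?Y. 1 / 4 ^ fst (fst r) * (1 / 4 ^ fst (snd r)))"
      by (simp only: sum_product sum.cartesian_product case_prod_unfold)
    then show ?thesis by (simp only: sum_distrib_left)
  qed
  also have "\<dots> \<le> 4 ^ N * (2 / (2 ^ fst (fst P) * 2 ^ c) * (2 / (2 ^ fst (snd P) * 2 ^ d)))"
    by (intro mult_left_mono mult_mono sum_refinements_le sum_nonneg) auto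
  also have "\<dots> = 4 * (2 ^ N / 2 ^ (fst (fst P) + fst (snd P))) * (2 ^ N / 2 ^ (c + d))"
    by (simp add: four power_add mult_ac)
  also have "\<dots> \<le> 4 * (2 ^ N / 2 ^ (fst (fst P) + fst (snd P))) * 1"
    using cd by (intro mult_left_mono) (auto simp: divide_le_eq_1)
  finally show ?thesis using mass_drect[OF P] by simp
qed

definition family_index :: "nat \<Rightarrow> ((nat \<times> nat) \<times> (nat \<times> nat)) set" where
  "family_index n = {r \<in> levels (depth n) \<times> levels (depth n).
     depth n \<le> fst (fst r) \<or> depth n \<le> fst (snd r) \<or>
     (\<exists>s\<in>quilt n. refines (fst r) (fst s) \<and> refines (snd r) (snd s))}"

abbreviation unif :: "nat \<Rightarrow> 'a \<Rightarrow> real" where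
  "unif n \<equiv> \<lambda>_. 1 / 2 ^ depth n"

lemma mass_quilt: "r \<in> quilt n \<Longrightarrow> mass (depth n) (unif n) (drect r) = 1"
  using quilt_subset_levels quilt_elem by (subst mass_drect) auto

lemma sum_Un_le:
  fixes f :: "'a \<Rightarrow> real"
  assumes "finite A" "finite B" "\<And>x. 0 \<le> f x" "sum f A \<le> a" "sum f B \<le> b"
  shows "sum f (A \<union> B) \<le> a + b"
  using sum.union_inter[OF assms(1,2), of f] sum_nonneg[of "A \<inter> B" f] assms(3-) by simp

text \<open>The constant is 5 * 4: two parts with a side of length 2^-N, two parts below quilt
  rectangles longer than \<open>P\<close> in one direction, and one part below quilt rectangles
  inside \<open>P\<close>.\<close>

lemma box_condition_index:
  assumes P: "P \<in> levels (depth n) \<times> levels (depth n)"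
  shows "(\<Sum>r | r \<in> family_index n \<and> refines (fst r) (fst P) \<and> refines (snd r) (snd P).
      (mass (depth n) (unif n) (drect r))\<^sup>2) \<le> 20 * mass (depth n) (unif n) (drect P)"
proof -
  let ?N = "depth n" and ?p = "fst (fst P)" and ?q = "fst (snd P)"
  let ?f = "\<lambda>r. (mass (depth n) (unif n) (drect r))\<^sup>2" and ?m = "mass (depth n) (unif n) (drect P)"
  let ?B = "\<lambda>s. {r \<in> levels ?N \<times> levels ?N. refines (fst r) (fst s) \<and> refines (snd r) (snd s)}"
  define A where "A c d = {r \<in> ?B P. c \<le> fst (fst r) \<and> d \<le> fst (snd r)}" for c d
  define Q where "Q = {s \<in> quilt n. refines (fst s) (fst P) \<and> refines (snd s) (snd P)}"
  have finB: "finite (?B s)" for s using finite_levels by auto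
  have finA: "finite (A c d)" for c d by (rule finite_subset[OF _ finB[of P]]) (auto simp: A_def)
  have finQ: "finite Q" using finite_quilt by (simp add: Q_def)
  have A: "sum ?f (A c d) \<le> 4 * ?m" if "?N \<le> c + d" for c d
    by (rule sum_mass_sq_le[OF P that]) (auto simp: A_def)
  \<comment> \<open>The levels of \<open>s\<close> serve as \<open>c\<close> and \<open>d\<close>;
    they add up to \<open>?N\<close> because \<open>s\<close> has area 2^-N.\<close>
  have B: "sum ?f (?B s) \<le> 4" if s: "s \<in> quilt n" for s
  proof -
    have "sum ?f (?B s) \<le> 4 * mass ?N (unif n) (drect s)"
      using quilt_subset_levels[of n] quilt_elem[OF s] s
      by (intro sum_mass_sq_le[where c = "fst (fst s)" and d = "fst (snd s)"])
        (auto simp: refines_def)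
    then show ?thesis using mass_quilt[OF s] by simp
  qed
  \<comment> \<open>Quilt rectangles overlap: the union is the projection of a disjoint sum, and
    projecting can only lower a sum of nonnegative terms.\<close>
  have "sum ?f (\<Union>s\<in>Q. ?B s) = sum ?f (snd ` (SIGMA s:Q. ?B s))"
    by (rule arg_cong[of _ _ "sum ?f"]) force
  also have "\<dots> \<le> (\<Sum>z\<in>(SIGMA s:Q. ?B s). ?f (snd z))"
    using finQ finB sum_image_le[of "SIGMA s:Q. ?B s" ?f snd] by (simp add: o_def)
  also have "\<dots> = (\<Sum>s\<in>Q. sum ?f (?B s))"
    using finQ finB by (subst sum.Sigma) (auto simp: case_prod_unfold)
  also have "\<dots> \<le> (\<Sum>s\<in>Q. 4)"
    by (rule sum_mono) (auto simp: Q_def intro: B)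
  also have "\<dots> \<le> 4 * ?m"
  proof -
    \<comment> \<open>By the packing bound, the number of quilt rectangles inside \<open>P\<close>
      is at most the mass of \<open>P\<close>.\<close>
    have "card Q * 2 ^ (?p + ?q) \<le> 2 ^ ?N"
      using quilt_packing[of n "fst P" "snd P"] by (simp add: count_below_def Q_def)
    then have "real (card Q * 2 ^ (?p + ?q)) \<le> real (2 ^ ?N)"
      by (simp only: of_nat_le_iff)
    then show ?thesis
      using mass_drect[OF P] by (simp add: pos_le_divide_eq)
  qed
  finally have U: "sum ?f (\<Union>s\<in>Q. ?B s) \<le> 4 * ?m" .
  \<comment> \<open>a quilt rectangle \<open>s\<close> with area \<open>2 ^ -?N\<close> that is not inside \<open>P\<close> is coarser than \<open>P\<close>
    in one direction, which forces the other direction to be fine\<close>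
  have sub: "{r. r \<in> family_index n \<and> refines (fst r) (fst P) \<and> refines (snd r) (snd P)} \<subseteq>
    (A ?N 0 \<union> A 0 ?N) \<union> (A ?p (?N - ?p) \<union> A (?N - ?q) ?q) \<union> (\<Union>s\<in>Q. ?B s)"
  proof
    fix r assume "r \<in> {r. r \<in> family_index n \<and> refines (fst r) (fst P) \<and> refines (snd r) (snd P)}"
    then have r: "r \<in> ?B P" and f: "r \<in> family_index n" by (auto simp: family_index_def)
    then have pq: "?p \<le> fst (fst r)" "?q \<le> fst (snd r)" by (auto simp: refines_def)
    from f consider "?N \<le> fst (fst r)" | "?N \<le> fst (snd r)"
      | s where "s \<in> quilt n" "refines (fst r) (fst s)" "refines (snd r) (snd s)"
      by (auto simp: family_index_def)
    then show "r \<in> (A ?N 0 \<union> A 0 ?N) \<union> (A ?p (?N - ?p) \<union> A (?N - ?q) ?q) \<union> (\<Union>s\<in>Q. ?B s)"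
    proof cases
      case 1
      then have "r \<in> A ?N 0" using r by (simp add: A_def)
      then show ?thesis by blast
    next
      case 2
      then have "r \<in> A 0 ?N" using r by (simp add: A_def)
      then show ?thesis by blast
    next
      case 3
      have lev: "fst (fst s) + fst (snd s) = ?N" using quilt_elem[OF 3(1)] by simp
      have rs: "fst (fst s) \<le> fst (fst r)" "fst (snd s) \<le> fst (snd r)"
        using 3 by (auto simp: refines_def)
      consider "fst (fst s) < ?p" | "fst (snd s) < ?q" | "?p \<le> fst (fst s)" "?q \<le> fst (snd s)"
        by linarith
      then show ?thesis
      proof cases
        case 1
        then have "r \<in> A ?p (?N - ?p)" using r pq rs lev by (simp add: A_def)
        then show ?thesis by blast
      next
        case 2
        then have "r \<in> A (?N - ?q) ?q" using r pq rs lev by (simp add: A_def)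
        then show ?thesis by blast
      next
        case inside: 3
        \<comment> \<open>\<open>r\<close> lies below both \<open>s\<close> and \<open>P\<close>, so
          their sides are nested, and the levels decide the direction.\<close>
        have "s \<in> Q"
          using 3 r inside refines_comparable[of "fst r" "fst s" "fst P"]
            refines_comparable[of "snd r" "snd s" "snd P"] by (auto simp: Q_def)
        moreover have "r \<in> ?B s" using r 3 by simp
        ultimately show ?thesis by blast
      qed
    qed
  qed
  have "(\<Sum>r | r \<in> family_index n \<and> refines (fst r) (fst P) \<and> refines (snd r) (snd P). ?f r)
    \<le> sum ?f ((A ?N 0 \<union> A 0 ?N) \<union> (A ?p (?N - ?p) \<union> A (?N - ?q) ?q) \<union> (\<Union>s\<in>Q. ?B s))"
    by (rule sum_mono2[OF _ sub]) (use finA finB finQ in auto)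
  also have "\<dots> \<le> (4 * ?m + 4 * ?m) + (4 * ?m + 4 * ?m) + 4 * ?m"
    by (intro sum_Un_le A U finite_UnI finite_UN_I finA finB finQ) auto
  also have "\<dots> = 20 * ?m" by simp
  finally show ?thesis .
qed

section \<open>From indices to sets of points\<close>

definition family :: "nat \<Rightarrow> (real \<times> real) set set" where
  "family n = drect ` family_index n"

lemma family_subset: "family n \<subseteq> dyadic_rects (depth n)"
  by (auto simp: family_def family_index_def dyadic_rects_eq)

lemma drect_in_family_iff: "drect r \<in> family n \<longleftrightarrow> r \<in> family_index n"
  using inj_drect by (simp add: family_def inj_image_mem_iff)

lemma quilt_subset_family: "drect ` quilt n \<subseteq> family n"
  using quilt_subset_levels by (fastforce simp: family_def family_index_def intro!: imageI refines_refl)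

lemma box_condition:
  assumes R\<^sub>0: "R\<^sub>0 \<in> dyadic_rects (depth n)"
  shows "(\<Sum>R | R \<in> family n \<and> R \<subseteq> R\<^sub>0. (mass (depth n) (unif n) R)\<^sup>2)
    \<le> 20 * mass (depth n) (unif n) R\<^sub>0"
proof -
  obtain P where P: "P \<in> levels (depth n) \<times> levels (depth n)" and RP: "R\<^sub>0 = drect P"
    using R\<^sub>0 by (auto simp: dyadic_rects_eq)
  have "{R. R \<in> family n \<and> R \<subseteq> R\<^sub>0} =
      drect ` {r. r \<in> family_index n \<and> drect r \<subseteq> drect P}"
    by (auto simp: family_def RP)
  also have "\<dots> = drect ` {r. r \<in> family_index n \<and> refines (fst r) (fst P) \<and> refines (snd r) (snd P)}"
    unfolding drect_subset_iff ..
  finally show ?thesis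
    using box_condition_index[OF P] inj_on_subset[OF inj_drect]
    by (simp add: sum.reindex RP)
qed

text \<open>The lower left corner of a small square in the union lies in a single quilt rectangle,
  which then contains the whole square since both are dyadic.\<close>

lemma mass_quilt_union_le:
  "mass (depth n) (unif n) (\<Union>(drect ` quilt n)) \<le> card (cells n) / 2 ^ depth n"
proof -
  let ?N = "depth n" and ?g = "\<lambda>(x, y). drect ((depth n, x), (depth n, y))"
  have "{\<omega>. \<omega> \<in> small_squares ?N \<and> \<omega> \<subseteq> \<Union>(drect ` quilt n)} \<subseteq> ?g ` cells n"
  proof clarify
    fix \<omega> assume w: "\<omega> \<in> small_squares ?N" and sub: "\<omega> \<subseteq> \<Union>(drect ` quilt n)"
    obtain x y where xy: "x < 2 ^ ?N" "y < 2 ^ ?N" and w: "\<omega> = drect ((?N, x), (?N, y))"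
      using w unfolding small_squares_eq by auto
    have "(real x / 2 ^ ?N, real y / 2 ^ ?N) \<in> \<omega>"
      by (simp add: w drect_def dyI_def dyadic_interval_left)
    then obtain s where s: "s \<in> quilt n" and m: "(real x / 2 ^ ?N, real y / 2 ^ ?N) \<in> drect s"
      using sub by blast
    have "fst (fst s) \<le> ?N" "fst (snd s) \<le> ?N"
      using quilt_elem[OF s] by auto
    then have "refines (?N, x) (fst s)" "refines (?N, y) (snd s)"
      using m by (auto simp: drect_def dyI_def refines_def grid_point_mem_iff)
    then have "(x, y) \<in> cells n"
      using xy s by (auto simp: cells_def)
    then show "\<omega> \<in> ?g ` cells n"
      by (intro image_eqI) (auto simp: w)
  qed
  then have "card {\<omega>. \<omega> \<in> small_squares ?N \<and> \<omega> \<subseteq> \<Union>(drect ` quilt n)} \<le> card (cells n)"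
    using finite_cells by (intro surj_card_le)
  then show ?thesis
    by (simp add: mass_def divide_right_mono)
qed

text \<open>The quilt rectangles alone suffice: there are \<open>2 ^ depth n\<close> of them, each
  of mass 1.\<close>

lemma quilt_energy_ge:
  "2 ^ depth n \<le> (\<Sum>R | R \<in> family n \<and> R \<subseteq> \<Union>(drect ` quilt n). (mass (depth n) (unif n) R)\<^sup>2)"
proof -
  have "2 ^ depth n = (\<Sum>R\<in>drect ` quilt n. (mass (depth n) (unif n) R)\<^sup>2)"
    using inj_on_subset[OF inj_drect] by (simp add: sum.reindex mass_quilt card_quilt)
  also have "\<dots> \<le> (\<Sum>R | R \<in> family n \<and> R \<subseteq> \<Union>(drect ` quilt n). (mass (depth n) (unif n) R)\<^sup>2)"
    using quilt_subset_family finite_subset[OF family_subset finite_dyadic_rects]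
    by (intro sum_mono2) auto
  finally show ?thesis .
qed

subsection \<open>Cut and pruned\<close>

lemma is_half_subset: "is_half J I \<Longrightarrow> J \<subseteq> I"
  by (auto simp: is_half_def)

lemma is_parent_subset: "is_parent P R \<Longrightarrow> R \<subseteq> P"
  using is_half_subset by (fastforce simp: is_parent_def)

text \<open>Passing to a subrectangle only raises levels and preserves refinement. In contrapositive
  form this is the cut property, since a child is contained in its parents.\<close>

lemma family_downward_closed:
  assumes P: "P \<in> family n" and R: "R \<in> dyadic_rects (depth n)" "R \<subseteq> P"
  shows "R \<in> family n"
proof -
  obtain s where s: "s \<in> family_index n" "P = drect s"
    using P by (auto simp: family_def)
  obtain r where r: "r \<in> levels (depth n) \<times> levels (depth n)" "R = drect r"
    using R by (auto simp: dyadic_rects_eq)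
  have rs: "refines (fst r) (fst s)" "refines (snd r) (snd s)"
    using R(2) by (simp_all add: s r drect_subset_iff)
  then have "fst (fst s) \<le> fst (fst r)" "fst (snd s) \<le> fst (snd r)"
    by (auto simp: refines_def)
  moreover have "refines (fst r) (fst t) \<and> refines (snd r) (snd t)"
    if "refines (fst s) (fst t) \<and> refines (snd s) (snd t)" for t
    using rs that by (blast intro: refines_trans)
  ultimately have "r \<in> family_index n"
    using s(1) r(1) unfolding family_index_def by fastforce
  then show ?thesis by (simp add: family_def r(2))
qed

lemma cut_bitree_family: "cut_bitree (depth n) (family n)"
  unfolding cut_bitree_def
proof (intro conjI ballI allI impI family_subset)
  fix R P assume R: "R \<in> dyadic_rects (depth n) - family n" and PR: "P \<rightarrow>\<^bsub>bitree (depth n)\<^esub> R"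
  have "P \<in> dyadic_rects (depth n)" "is_parent P R"
    using PR by (auto simp: arcs_ends_conv bitree_def)
  then show "P \<in> dyadic_rects (depth n) - family n"
    using R family_downward_closed is_parent_subset by blast
qed

text \<open>The parity of \<open>i\<close> selects the left or the right half.\<close>

lemma is_half_dyI: "is_half (dyI (Suc k, i)) (dyI (k, i div 2))"
proof -
  define a b where "a = real (i div 2) / 2 ^ k" and "b = (real (i div 2) + 1) / 2 ^ k"
  have ab: "a < b" by (simp add: a_def b_def divide_strict_right_mono)
  have I: "dyI (k, i div 2) = {a..<b}"
    by (simp add: dyI_def dyadic_interval_def a_def b_def)
  have m: "(a + b) / 2 = (2 * real (i div 2) + 1) / 2 ^ Suc k"
    by (simp add: a_def b_def add_divide_distrib[symmetric])
  show ?thesis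
  proof (cases "even i")
    case True
    then have "real i = 2 * real (i div 2)" by (auto elim: evenE)
    then have "dyI (Suc k, i) = {a..<(a + b) / 2}"
      unfolding m by (simp add: dyI_def dyadic_interval_def a_def)
    then show ?thesis unfolding is_half_def using I ab by blast
  next
    case False
    then have i: "real i = 2 * real (i div 2) + 1" by (auto elim: oddE)
    have "b = (2 * real (i div 2) + 1 + 1) / 2 ^ Suc k"
      by (simp add: b_def field_simps)
    then have "dyI (Suc k, i) = {(a + b) / 2..<b}"
      unfolding m by (simp add: dyI_def dyadic_interval_def i)
    then show ?thesis unfolding is_half_def using I ab by blast
  qed
qed

section \<open>Connectedness of the induced graph\<close>

definition adjacent :: "nat \<Rightarrow> ((real \<times> real) set \<times> (real \<times> real) set) set" where
  "adjacent n = {(P, R). P \<in> family n \<and> R \<in> family n \<and> (is_parent P R \<or> is_parent R P)}"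

lemma sym_adjacent: "sym (adjacent n)"
  by (auto simp: adjacent_def sym_def)

lemma adjacent_horizontal:
  assumes "((k, i div 2), b) \<in> family_index n" "((Suc k, i), b) \<in> family_index n"
  shows "(drect ((Suc k, i), b), drect ((k, i div 2), b)) \<in> adjacent n"
proof -
  have "is_parent (drect ((k, i div 2), b)) (drect ((Suc k, i), b))"
    unfolding is_parent_def drect_def fst_conv snd_conv using is_half_dyI by blast
  then show ?thesis using assms by (auto simp: adjacent_def drect_in_family_iff)
qed

lemma adjacent_vertical:
  assumes "(b, (k, i div 2)) \<in> family_index n" "(b, (Suc k, i)) \<in> family_index n"
  shows "(drect (b, (Suc k, i)), drect (b, (k, i div 2))) \<in> adjacent n"
proof -
  have "is_parent (drect (b, (k, i div 2))) (drect (b, (Suc k, i)))"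
    unfolding is_parent_def drect_def fst_conv snd_conv using is_half_dyI by blast
  then show ?thesis using assms by (auto simp: adjacent_def drect_in_family_iff)
qed

text \<open>Every rectangle of width 2^-N belongs to the family, so its height can be doubled
  repeatedly without leaving the family.\<close>

lemma connected_to_column:
  assumes "i < 2 ^ depth n" "(l, j) \<in> levels (depth n)"
  shows "(drect ((depth n, i), (l, j)), drect ((depth n, i), (0, 0))) \<in> (adjacent n)\<^sup>*"
  using assms(2)
proof (induction l arbitrary: j)
  case 0
  then show ?case by (simp add: levels_def)
next
  case (Suc l)
  have lev: "(l, j div 2) \<in> levels (depth n)" "(depth n, i) \<in> levels (depth n)"
    using Suc.prems assms(1) by (auto simp: levels_def)
  then have "(drect ((depth n, i), (Suc l, j)), drect ((depth n, i), (l, j div 2))) \<in> adjacent n"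
    using Suc.prems by (intro adjacent_vertical) (simp_all add: family_index_def)
  then show ?case
    using Suc.IH[OF lev(1)] by (rule converse_rtrancl_into_rtrancl)
qed

lemma connected_to_row:
  assumes "j < 2 ^ depth n" "(k, i) \<in> levels (depth n)"
  shows "(drect ((k, i), (depth n, j)), drect ((0, 0), (depth n, j))) \<in> (adjacent n)\<^sup>*"
  using assms(2)
proof (induction k arbitrary: i)
  case 0
  then show ?case by (simp add: levels_def)
next
  case (Suc k)
  have lev: "(k, i div 2) \<in> levels (depth n)" "(depth n, j) \<in> levels (depth n)"
    using Suc.prems assms(1) by (auto simp: levels_def)
  then have "(drect ((Suc k, i), (depth n, j)), drect ((k, i div 2), (depth n, j))) \<in> adjacent n"
    using Suc.prems by (intro adjacent_horizontal) (simp_all add: family_index_def)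
  then show ?case
    using Suc.IH[OF lev(1)] by (rule converse_rtrancl_into_rtrancl)
qed

text \<open>Downward closure permits halving the width down to 2^-N, taking the left half each
  time.\<close>

lemma connected_to_thin:
  assumes "((k, i), b) \<in> family_index n"
  shows "\<exists>i'. i' < 2 ^ depth n \<and> (drect ((k, i), b), drect ((depth n, i'), b)) \<in> (adjacent n)\<^sup>*"
  using assms
proof (induction "depth n - k" arbitrary: k i)
  case 0
  then have "k = depth n" "i < 2 ^ depth n" by (auto simp: family_index_def levels_def)
  then show ?case by blast
next
  case (Suc d)
  have k: "Suc k \<le> depth n" and i: "i < 2 ^ k" and b: "b \<in> levels (depth n)"
    using Suc.hyps(2) Suc.prems by (auto simp: family_index_def levels_def)
  have "drect ((Suc k, 2 * i), b) \<subseteq> drect ((k, i), b)"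
    by (simp add: drect_subset_iff refines_refl) (simp add: refines_def)
  moreover have "drect ((Suc k, 2 * i), b) \<in> dyadic_rects (depth n)"
    using k i b by (auto simp: dyadic_rects_eq levels_def intro!: imageI)
  ultimately have f: "((Suc k, 2 * i), b) \<in> family_index n"
    using Suc.prems family_downward_closed drect_in_family_iff by blast
  have "d = depth n - Suc k" using Suc.hyps(2) by simp
  then obtain i' where i': "i' < 2 ^ depth n"
    "(drect ((Suc k, 2 * i), b), drect ((depth n, i'), b)) \<in> (adjacent n)\<^sup>*"
    using Suc.hyps(1)[OF _ f] by blast
  have "(drect ((Suc k, 2 * i), b), drect ((k, i), b)) \<in> adjacent n"
    using adjacent_horizontal[of k "2 * i" b n] f Suc.prems by simp
  then have "(drect ((k, i), b), drect ((Suc k, 2 * i), b)) \<in> adjacent n"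
    by (rule symD[OF sym_adjacent])
  then show ?case using i' by (blast intro: converse_rtrancl_into_rtrancl)
qed

text \<open>The root is the bottom row of height 2^-N. The path narrows to width 2^-N, grows to a
  full column, shrinks to the bottom small square, and widens to the full row.\<close>

lemma connected_to_root:
  assumes "R \<in> family n"
  shows "(R, drect ((0, 0), (depth n, 0))) \<in> (adjacent n)\<^sup>*"
proof -
  obtain k i l j where r: "((k, i), (l, j)) \<in> family_index n" "R = drect ((k, i), (l, j))"
    using assms by (auto simp: family_def)
  have lj: "(l, j) \<in> levels (depth n)" using r(1) by (auto simp: family_index_def)
  obtain i' where i': "i' < 2 ^ depth n"
    "(R, drect ((depth n, i'), (l, j))) \<in> (adjacent n)\<^sup>*"
    using connected_to_thin[OF r(1)] r(2) by blast
  have lev: "(depth n, 0) \<in> levels (depth n)" "(depth n, i') \<in> levels (depth n)"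
    using i'(1) by (auto simp: levels_def)
  have "(drect ((depth n, i'), (0, 0)), drect ((depth n, i'), (depth n, 0))) \<in> (adjacent n)\<^sup>*"
    by (rule symD[OF sym_rtrancl[OF sym_adjacent]], rule connected_to_column[OF i'(1) lev(1)])
  moreover have "(drect ((depth n, i'), (depth n, 0)), drect ((0, 0), (depth n, 0))) \<in> (adjacent n)\<^sup>*"
    by (rule connected_to_row) (simp_all add: lev)
  ultimately show ?thesis
    by (rule rtrancl_trans[OF rtrancl_trans[OF i'(2) connected_to_column[OF i'(1) lj]] rtrancl_trans])
qed

lemma small_squares_subset_family: "small_squares (depth n) \<subseteq> family n"
  by (auto simp: small_squares_eq drect_in_family_iff family_index_def levels_def)

lemma pruned_bitree_family: "pruned_bitree (depth n) (family n)"
proof -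
  let ?G = "bitree (depth n) \<restriction> family n"
  have adj: "adjacent n \<subseteq> (arcs_ends ?G)\<^sup>s"
  proof
    fix e assume "e \<in> adjacent n"
    then obtain P R where e: "e = (P, R)" and f: "P \<in> family n" "R \<in> family n"
      and p: "is_parent P R \<or> is_parent R P"
      by (auto simp: adjacent_def)
    have "(P, R) \<in> arcs_ends ?G" if "P \<in> family n" "R \<in> family n" "is_parent P R" for P R
      using that family_subset by (fastforce simp: arcs_ends_conv bitree_def induce_subgraph_def)
    then have "(P, R) \<in> arcs_ends ?G \<or> (R, P) \<in> arcs_ends ?G"
      using f p by blast
    then show "e \<in> (arcs_ends ?G)\<^sup>s"
      unfolding e symcl_def by auto
  qed
  \<comment> \<open>Both ends of an adjacent pair lie in the family, so a path stays inside the
    vertex set, as \<open>rtrancl_on\<close> demands.\<close>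
  have on: "(u, v) \<in> rtrancl_on (family n) ((arcs_ends ?G)\<^sup>s)"
    if "(u, v) \<in> (adjacent n)\<^sup>*" "u \<in> family n" for u v
    using that
  proof (induction rule: rtrancl_induct)
    case base
    then show ?case by simp
  next
    case (step y z)
    then show ?case
      using adj by (auto simp: adjacent_def intro: rtrancl_on_into_rtrancl_on)
  qed
  have "(u, v) \<in> (adjacent n)\<^sup>*" if "u \<in> family n" "v \<in> family n" for u v
    using that connected_to_root symD[OF sym_rtrancl[OF sym_adjacent]] by (meson rtrancl_trans)
  then have "\<forall>u\<in>family n. \<forall>v\<in>family n. (u, v) \<in> rtrancl_on (family n) ((arcs_ends ?G)\<^sup>s)"
    using on by blast
  \<comment> \<open>Connectedness includes having a vertex.\<close>
  moreover have "family n \<noteq> {}"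
  proof -
    have "quilt n \<noteq> {}" using card_quilt[of n] by auto
    then show ?thesis using quilt_subset_family by blast
  qed
  ultimately have "Digraph_Component.connected ?G"
    by (simp add: connected_conv)
  then show ?thesis
    by (simp add: pruned_bitree_def family_subset small_squares_subset_family)
qed

theorem theorem1p11:
  "\<exists>C\<^sub>0::real. C\<^sub>0 > 0 \<and>
     (\<forall>C\<^sub>1::real. C\<^sub>1 > 0 \<longrightarrow>
       (\<exists>(N::nat) F \<mu> F'.
          N > 0 \<and> F \<subseteq> dyadic_rects N \<and> cut_bitree N F \<and> pruned_bitree N F \<and>
          grid_measure N \<mu> \<and> F' \<subseteq> F \<and>
          (\<forall>R\<^sub>0\<in>dyadic_rects N.
             (\<Sum>R | R \<in> F \<and> R \<subseteq> R\<^sub>0. (mass N \<mu> R)\<^sup>2) \<le> C\<^sub>0 * mass N \<mu> R\<^sub>0) \<and>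
          (\<Sum>R | R \<in> F \<and> R \<subseteq> \<Union>F'. (mass N \<mu> R)\<^sup>2) > C\<^sub>1 * mass N \<mu> (\<Union>F')))"
proof (intro exI[of _ "20::real"] conjI allI impI)
  fix C\<^sub>1 :: real assume C: "C\<^sub>1 > 0"
  \<comment> \<open>The mass of the union is at most 4/(n+4) times the energy bound
    \<open>2 ^ depth n\<close>, so \<open>n\<close> beyond \<open>4 * C\<^sub>1\<close> suffices;
    taking a successor makes the depth positive.\<close>
  obtain m :: nat where m: "4 * C\<^sub>1 < real m" using reals_Archimedean2 by blast
  define n where "n = Suc m"
  have "C\<^sub>1 * mass (depth n) (unif n) (\<Union>(drect ` quilt n)) \<le> C\<^sub>1 * (card (cells n) / 2 ^ depth n)"
    using C by (intro mult_left_mono mass_quilt_union_le) simp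
  also have "\<dots> \<le> C\<^sub>1 * (4 / (real n + 4) * 4 ^ depth n / 2 ^ depth n)"
    using C cells_density by (intro mult_left_mono divide_right_mono) auto
  also have "\<dots> = C\<^sub>1 * 4 / (real n + 4) * 2 ^ depth n"
    using power_mult_distrib[of "2::real" 2 "depth n"] by simp
  also have "\<dots> < 1 * 2 ^ depth n"
    using m by (intro mult_strict_right_mono) (auto simp: n_def)
  also have "\<dots> \<le> (\<Sum>R | R \<in> family n \<and> R \<subseteq> \<Union>(drect ` quilt n). (mass (depth n) (unif n) R)\<^sup>2)"
    using quilt_energy_ge by simp
  finally have "C\<^sub>1 * mass (depth n) (unif n) (\<Union>(drect ` quilt n)) <
    (\<Sum>R | R \<in> family n \<and> R \<subseteq> \<Union>(drect ` quilt n). (mass (depth n) (unif n) R)\<^sup>2)" .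
  moreover have "depth n > 0" by (simp add: n_def)
  moreover have "grid_measure (depth n) (unif n)" by (simp add: grid_measure_def)
  moreover have "\<forall>R\<^sub>0\<in>dyadic_rects (depth n).
      (\<Sum>R | R \<in> family n \<and> R \<subseteq> R\<^sub>0. (mass (depth n) (unif n) R)\<^sup>2)
        \<le> 20 * mass (depth n) (unif n) R\<^sub>0"
    using box_condition by blast
  ultimately show "\<exists>(N::nat) F \<mu> F'.
          N > 0 \<and> F \<subseteq> dyadic_rects N \<and> cut_bitree N F \<and> pruned_bitree N F \<and>
          grid_measure N \<mu> \<and> F' \<subseteq> F \<and>
          (\<forall>R\<^sub>0\<in>dyadic_rects N.
             (\<Sum>R | R \<in> F \<and> R \<subseteq> R\<^sub>0. (mass N \<mu> R)\<^sup>2) \<le> 20 * mass N \<mu> R\<^sub>0) \<and>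
          (\<Sum>R | R \<in> F \<and> R \<subseteq> \<Union>F'. (mass N \<mu> R)\<^sup>2) > C\<^sub>1 * mass N \<mu> (\<Union>F')"
    by (intro exI[of _ "depth n"] exI[of _ "family n"] exI[of _ "unif n"] exI[of _ "drect ` quilt n"]
        conjI family_subset cut_bitree_family pruned_bitree_family quilt_subset_family)
qed simp

end
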